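(* Let $R$ be a ring, let $G=\{g_1,g_2,\ldots,g_n\}$ be a finite group of order $n$ with a fixed listing of its elements, and let $u=\sum_{i=1}^{n}\alpha_i g_i$ be an element of the group ring $RG$ (with $\alpha_i\in R$). Let $U$ be the $n\times n$ matrix over $R$ associated with $u$ relative to this listing, and let $DS(u)$ be the collection of (group) differences of $u$. Then the matrix $U$ has no short cycles in its graph if and only if $DS(u)$ has no repeated (group) elements.
   Context: Matrix of a group ring element: for $u\in RG$ and the listing $g_1,\ldots,g_n$ of $G$, the rows of $U$ correspond in order to $ug_1,ug_2,\ldots,ug_n$; that is, the $(i,j)$ entry of $U$ is the coefficient of $g_j$ in $ug_i$. Graph and short cycles: the (Tanner) graph of a matrix $H=(h_{ij})$ is the bipartite graph with one vertex for each row of $H$ and one vertex for each column of $H$, and an edge between row vertex $i$ and column vertex $j$ exactly when $h_{ij}\neq 0$. A short cycle is a cycle of length $4$ in this graph. Equivalently, a matrix has no short cycles if and only if, for any two distinct columns, the number of row positions in which both columns have non-zero entries is at most $1$. Collection of differences: for $u=\sum_{i=1}^n\alpha_i g_i$, $DS(u)$ is the collection (multiset, counted with repetition) of all group elements $g_ig_j^{-1}$ indexed by the ordered pairs $(i,j)$ with $i\neq j$, $\alpha_i\neq 0$, $\alpha_j\neq 0$. (So for each unordered pair of distinct group elements $g,h$ occurring in $u$ with non-zero coefficients, both $gh^{-1}$ and $hg^{-1}$ are listed.) $DS(u)$ has a repeated element if the same group element arises from two different ordered pairs $(i,j)$. *)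

theory Defs
  imports
    "HOL-Algebra.Coset"
    "HOL-Algebra.Module"
    "HOL-Library.Multiset"
    "Jordan_Normal_Form.Matrix"
    "Graph_Theory.Pair_Digraph"
begin

text \<open>
  The group ring \<open>RG\<close>: an element \<open>u\<close> is its coefficient function, \<open>u g\<close> being the coefficient of
  \<open>g\<close>. Coefficient functions are extensional, so that elements of \<open>RG\<close> are determined on \<open>carrier G\<close>.
  Multiplication is convolution; the sum is restricted to pairs with non-zero coefficients because
  \<^term>\<open>finsum\<close> over an infinite index set is a dummy value.
\<close>

definition group_ring :: "('r, 'm) ring_scheme \<Rightarrow> ('g, 'k) monoid_scheme \<Rightarrow> ('r, 'g \<Rightarrow> 'r) module"
  where "group_ring R G =
    \<lparr> carrier = {u \<in> carrier G \<rightarrow>\<^sub>E carrier R. finite {g \<in> carrier G. u g \<noteq> \<zero>\<^bsub>R\<^esub>}},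
      monoid.mult = (\<lambda>u v. \<lambda>x\<in>carrier G.
        \<Oplus>\<^bsub>R\<^esub>p\<in>{p \<in> carrier G \<times> carrier G. fst p \<otimes>\<^bsub>G\<^esub> snd p = x \<and> u (fst p) \<noteq> \<zero>\<^bsub>R\<^esub> \<and> v (snd p) \<noteq> \<zero>\<^bsub>R\<^esub>}.
          u (fst p) \<otimes>\<^bsub>R\<^esub> v (snd p)),
      one = (\<lambda>x\<in>carrier G. if x = \<one>\<^bsub>G\<^esub> then \<one>\<^bsub>R\<^esub> else \<zero>\<^bsub>R\<^esub>),
      zero = (\<lambda>x\<in>carrier G. \<zero>\<^bsub>R\<^esub>),
      add = (\<lambda>u v. \<lambda>x\<in>carrier G. u x \<oplus>\<^bsub>R\<^esub> v x),
      smult = (\<lambda>a u. \<lambda>x\<in>carrier G. a \<otimes>\<^bsub>R\<^esub> u x) \<rparr>"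

text \<open>The group element \<open>g\<close>, viewed in \<open>RG\<close> as \<open>1 g\<close>.\<close>

definition group_elem :: "('r, 'm) ring_scheme \<Rightarrow> ('g, 'k) monoid_scheme \<Rightarrow> 'g \<Rightarrow> 'g \<Rightarrow> 'r"
  where "group_elem R G g = (\<lambda>x\<in>carrier G. if x = g then \<one>\<^bsub>R\<^esub> else \<zero>\<^bsub>R\<^esub>)"

text \<open>A listing \<open>g\<^sub>1, \<dots>, g\<^sub>n\<close> of \<open>G\<close> is a list \<open>gs\<close>; indices start at 0, so \<open>g\<^sub>i\<close> is \<open>gs ! (i - 1)\<close>.\<close>

definition group_ring_matrix ::
    "('r, 'm) ring_scheme \<Rightarrow> ('g, 'k) monoid_scheme \<Rightarrow> 'g list \<Rightarrow> ('g \<Rightarrow> 'r) \<Rightarrow> 'r mat"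
  where "group_ring_matrix R G gs u =
    mat (length gs) (length gs)
      (\<lambda>(i, j). (u \<otimes>\<^bsub>group_ring R G\<^esub> group_elem R G (gs ! i)) (gs ! j))"

text \<open>
  The undirected bipartite graph of a matrix, as a symmetric digraph: row \<open>i\<close> is the vertex
  \<open>Inl i\<close>, column \<open>j\<close> is \<open>Inr j\<close>, and an edge is a pair of opposite arcs. The ring is an argument
  only to supply the zero against which entries are compared.
\<close>

definition tanner_graph :: "('r, 'm) ring_scheme \<Rightarrow> 'r mat \<Rightarrow> (nat + nat) pair_pre_digraph"
  where "tanner_graph R H =
    \<lparr> pverts = Inl ` {..<dim_row H} \<union> Inr ` {..<dim_col H},
      parcs = (\<Union>i<dim_row H. \<Union>j\<in>{j. j < dim_col H \<and> H $$ (i, j) \<noteq> \<zero>\<^bsub>R\<^esub>}.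
        {(Inl i, Inr j), (Inr j, Inl i)}) \<rparr>"

text \<open>
  The library's \<^const>\<open>pre_digraph.cycle\<close> requires pairwise distinct vertices. It also admits
  going along an edge and back, but such a closed walk has length 2, so at length 4 exactly the
  usual 4-cycles of the undirected graph remain.
\<close>

definition has_short_cycle :: "('r, 'm) ring_scheme \<Rightarrow> 'r mat \<Rightarrow> bool"
  where "has_short_cycle R H \<longleftrightarrow>
    (\<exists>p. pre_digraph.cycle (with_proj (tanner_graph R H)) p \<and> length p = 4)"

definition DS :: "('r, 'm) ring_scheme \<Rightarrow> ('g, 'k) monoid_scheme \<Rightarrow> 'g list \<Rightarrow> ('g \<Rightarrow> 'r) \<Rightarrow> 'g multiset"
  where "DS R G gs u =
    {# gs ! i \<otimes>\<^bsub>G\<^esub> inv\<^bsub>G\<^esub> (gs ! j).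
       (i, j) \<in># mset_set {(i, j). i < length gs \<and> j < length gs \<and> i \<noteq> j \<and>
         u (gs ! i) \<noteq> \<zero>\<^bsub>R\<^esub> \<and> u (gs ! j) \<noteq> \<zero>\<^bsub>R\<^esub>} #}"

definition has_repeated_element :: "'a multiset \<Rightarrow> bool"
  where "has_repeated_element M \<longleftrightarrow> (\<exists>x. count M x \<ge> 2)"

end

theory Submission
  imports Defs
begin

text \<open>
  The coefficient of \<open>g\<^sub>j\<close> in \<open>u g\<^sub>i\<close> is the coefficient of \<open>g\<^sub>j g\<^sub>i\<inverse>\<close> in \<open>u\<close>. Hence a short cycle
  through rows \<open>g, h\<close> and columns \<open>a, b\<close> amounts to \<open>a g\<inverse>\<close>, \<open>b g\<inverse>\<close>, \<open>a h\<inverse>\<close>, \<open>b h\<inverse>\<close> all lying in the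
  support of \<open>u\<close>, and then \<open>(a g\<inverse>) (b g\<inverse>)\<inverse> = a b\<inverse> = (a h\<inverse>) (b h\<inverse>)\<inverse>\<close> is a repeated difference.
  Conversely, if \<open>x y\<inverse> = x' y'\<inverse>\<close> is a repeated difference, the rows \<open>x\<inverse>, x'\<inverse>\<close> and the columns
  \<open>1, y x\<inverse> = y' x'\<inverse>\<close> carry a short cycle.
\<close>

lemma parcs_tanner_graph_iff:
  "(Inl i, w) \<in> parcs (tanner_graph R H) \<longleftrightarrow>
    (\<exists>j. w = Inr j \<and> i < dim_row H \<and> j < dim_col H \<and> H $$ (i, j) \<noteq> \<zero>\<^bsub>R\<^esub>)"
  "(Inr j, w) \<in> parcs (tanner_graph R H) \<longleftrightarrow>
    (\<exists>i. w = Inl i \<and> i < dim_row H \<and> j < dim_col H \<and> H $$ (i, j) \<noteq> \<zero>\<^bsub>R\<^esub>)"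
  by (auto simp: tanner_graph_def)

text \<open>Arcs alternate between rows and columns, so a closed walk of length 4 visits two rows
  and two columns; distinctness of its vertices makes them a genuine 2 by 2 submatrix of non-zero
  entries.\<close>

lemma has_short_cycle_iff:
  "has_short_cycle R H \<longleftrightarrow>
    (\<exists>i<dim_row H. \<exists>k<dim_row H. \<exists>a<dim_col H. \<exists>b<dim_col H. i \<noteq> k \<and> a \<noteq> b \<and>
      H $$ (i, a) \<noteq> \<zero>\<^bsub>R\<^esub> \<and> H $$ (i, b) \<noteq> \<zero>\<^bsub>R\<^esub> \<and> H $$ (k, a) \<noteq> \<zero>\<^bsub>R\<^esub> \<and> H $$ (k, b) \<noteq> \<zero>\<^bsub>R\<^esub>)"
  (is "?L \<longleftrightarrow> ?R")
proof
  assume ?L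
  then obtain p where p: "pre_digraph.cycle (with_proj (tanner_graph R H)) p" "length p = 4"
    unfolding has_short_cycle_def by blast
  from p(2) obtain e1 e2 e3 e4 where "p = [e1, e2, e3, e4]"
    by (auto simp: numeral_eq_Suc length_Suc_conv)
  then obtain v1 w1 v2 w2 v3 w3 v4 w4 where "p = [(v1, w1), (v2, w2), (v3, w3), (v4, w4)]"
    by (metis surj_pair)
  \<comment> \<open>The tail of the vertex list drops the starting point, which returns as the last
    vertex; hence \<open>v1\<close> stands at the end of the distinct list.\<close>
  with p(1) have arcs: "(v1, v2) \<in> parcs (tanner_graph R H)" "(v2, v3) \<in> parcs (tanner_graph R H)"
      "(v3, v4) \<in> parcs (tanner_graph R H)" "(v4, v1) \<in> parcs (tanner_graph R H)"
    and dist: "distinct [v2, v3, v4, v1]"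
    by (auto simp: pre_digraph.cycle_def pre_digraph.awalk_def pre_digraph.cas.simps
        pre_digraph.awalk_verts.simps)
  then show ?R
  \<comment> \<open>The walk may start at a row or at a column; each case fixes the side of the
    other three vertices.\<close>
  proof (cases v1)
    case (Inl i)
    with arcs obtain a k b where "v2 = Inr a" "v3 = Inl k" "v4 = Inr b"
      by (auto simp: parcs_tanner_graph_iff)
    with Inl arcs dist show ?thesis
      by (simp add: parcs_tanner_graph_iff) blast
  next
    case (Inr a)
    with arcs obtain i b k where "v2 = Inl i" "v3 = Inr b" "v4 = Inl k"
      by (auto simp: parcs_tanner_graph_iff)
    with Inr arcs dist show ?thesis
      by (simp add: parcs_tanner_graph_iff) blast
  qed
next
  assume ?R
  then obtain i k a b where *: "i < dim_row H" "k < dim_row H" "a < dim_col H" "b < dim_col H"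
    "i \<noteq> k" "a \<noteq> b" "H $$ (i, a) \<noteq> \<zero>\<^bsub>R\<^esub>" "H $$ (i, b) \<noteq> \<zero>\<^bsub>R\<^esub>" "H $$ (k, a) \<noteq> \<zero>\<^bsub>R\<^esub>" "H $$ (k, b) \<noteq> \<zero>\<^bsub>R\<^esub>"
    by blast
  let ?p = "[(Inl i, Inr a), (Inr a, Inl k), (Inl k, Inr b), (Inr b, Inl i)]"
  have "pre_digraph.cycle (with_proj (tanner_graph R H)) ?p"
    unfolding pre_digraph.cycle_def pre_digraph.awalk_def pre_digraph.cas.simps
      pre_digraph.awalk_verts.simps
    using * by (intro exI[of _ "Inl i"]) 
      (simp add: parcs_tanner_graph_iff, simp add: tanner_graph_def)
  then show ?L
    unfolding has_short_cycle_def by (intro exI[of _ ?p]) simp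
qed

text \<open>The multiplicity of \<open>x\<close> is the size of the fibre of \<open>f\<close> over
  \<open>x\<close>, so a repetition is a fibre with two points.\<close>

lemma has_repeated_element_image_mset_iff:
  assumes "finite A"
  shows "has_repeated_element (image_mset f (mset_set A)) \<longleftrightarrow> \<not> inj_on f A"
proof -
  have "count (image_mset f (mset_set A)) x = card {a \<in> A. f a = x}" for x
    using assms by (auto simp: count_image_mset' intro!: arg_cong[where f = card])
  moreover have "card {a \<in> A. f a = x} \<ge> 2 \<longleftrightarrow>
      (\<exists>a\<in>A. \<exists>b\<in>A. a \<noteq> b \<and> f a = x \<and> f b = x)" for x
    using card_le_Suc0_iff_eq[of "{a \<in> A. f a = x}"] assms by fastforce
  ultimately show ?thesis
    by (fastforce simp: has_repeated_element_def inj_on_def)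
qed

text \<open>For a listing without repetitions, indexing is a bijection from index pairs to pairs of
  elements, so re-indexing preserves multiplicities.\<close>

lemma DS_eq:
  assumes "distinct gs"
  shows "DS R G gs u = image_mset (\<lambda>(x, y). x \<otimes>\<^bsub>G\<^esub> inv\<^bsub>G\<^esub> y)
    (mset_set {(x, y). x \<in> set gs \<and> y \<in> set gs \<and> x \<noteq> y \<and> u x \<noteq> \<zero>\<^bsub>R\<^esub> \<and> u y \<noteq> \<zero>\<^bsub>R\<^esub>})"
proof -
  let ?I = "{(i, j). i < length gs \<and> j < length gs \<and> i \<noteq> j \<and> u (gs ! i) \<noteq> \<zero>\<^bsub>R\<^esub> \<and> u (gs ! j) \<noteq> \<zero>\<^bsub>R\<^esub>}"
  let ?P = "{(x, y). x \<in> set gs \<and> y \<in> set gs \<and> x \<noteq> y \<and> u x \<noteq> \<zero>\<^bsub>R\<^esub> \<and> u y \<noteq> \<zero>\<^bsub>R\<^esub>}"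
  let ?f = "map_prod ((!) gs) ((!) gs)"
  have inj: "inj_on ?f ?I"
    using assms by (auto simp: inj_on_def nth_eq_iff_index_eq)
  have "?f ` ?I = ?P"
    using assms by (force simp: in_set_conv_nth nth_eq_iff_index_eq image_iff)
  then have "mset_set ?P = image_mset ?f (mset_set ?I)"
    using image_mset_mset_set[OF inj] by simp
  then show ?thesis
    by (auto simp: DS_def multiset.map_comp intro!: image_mset_cong)
qed

text \<open>The group-theoretic core, to be applied with \<open>S\<close> the support of
  \<open>u\<close>: \<open>g\<close>, \<open>h\<close> label rows and \<open>a\<close>,
  \<open>b\<close> label columns.\<close>

lemma (in group) quotient_rectangle_iff:
  assumes "S \<subseteq> carrier G"
  shows "(\<exists>g\<in>carrier G. \<exists>h\<in>carrier G. \<exists>a\<in>carrier G. \<exists>b\<in>carrier G. g \<noteq> h \<and> a \<noteq> b \<and>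
      a \<otimes> inv g \<in> S \<and> b \<otimes> inv g \<in> S \<and> a \<otimes> inv h \<in> S \<and> b \<otimes> inv h \<in> S) \<longleftrightarrow>
    \<not> inj_on (\<lambda>(x, y). x \<otimes> inv y) {(x, y). x \<in> S \<and> y \<in> S \<and> x \<noteq> y}"
  (is "?L \<longleftrightarrow> ?R")
proof
  assume ?L
  then obtain g h a b where *: "g \<in> carrier G" "h \<in> carrier G" "a \<in> carrier G" "b \<in> carrier G"
    "g \<noteq> h" "a \<noteq> b" "a \<otimes> inv g \<in> S" "b \<otimes> inv g \<in> S" "a \<otimes> inv h \<in> S" "b \<otimes> inv h \<in> S"
    by blast
  have eq: "(a \<otimes> inv k) \<otimes> inv (b \<otimes> inv k) = a \<otimes> inv b" if "k \<in> carrier G" for k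
    using that * by (simp add: inv_mult_group m_assoc inv_solve_left')
  \<comment> \<open>The first two inequalities place both pairs in the domain; the third makes the
    pairs different.\<close>
  have ne: "a \<otimes> inv g \<noteq> b \<otimes> inv g" "a \<otimes> inv h \<noteq> b \<otimes> inv h" "a \<otimes> inv g \<noteq> a \<otimes> inv h"
    using * by (auto simp: inj_on_eq_iff[OF inv_inj])
  show ?R
  proof
    assume "inj_on (\<lambda>(x, y). x \<otimes> inv y) {(x, y). x \<in> S \<and> y \<in> S \<and> x \<noteq> y}"
    from inj_onD[OF this, of "(a \<otimes> inv g, b \<otimes> inv g)" "(a \<otimes> inv h, b \<otimes> inv h)"]
    show False using * ne eq by simp
  qed
next
  assume ?R
  then obtain x y x' y' where *: "x \<in> S" "y \<in> S" "x' \<in> S" "y' \<in> S" "x \<noteq> y" "x' \<noteq> y'"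
    "(x, y) \<noteq> (x', y')" and eq: "x \<otimes> inv y = x' \<otimes> inv y'"
    by (auto simp: inj_on_def)
  have c: "x \<in> carrier G" "y \<in> carrier G" "x' \<in> carrier G" "y' \<in> carrier G"
    using * assms by auto
  have "inv (x \<otimes> inv y) = inv (x' \<otimes> inv y')"
    using eq by simp
  then have eq': "y \<otimes> inv x = y' \<otimes> inv x'"
    using c by (simp add: inv_mult_group)
  \<comment> \<open>If \<open>x = x'\<close>, cancelling in \<open>eq'\<close> gives
    \<open>y = y'\<close>, and the two pairs would coincide.\<close>
  have "x \<noteq> x'"
    using * eq' c by auto
  then have "inv x \<noteq> inv x'"
    using c by (simp add: inj_on_eq_iff[OF inv_inj])
  moreover have "\<one> \<noteq> y \<otimes> inv x"
    using c * by (metis inv_solve_right l_one one_closed)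
  moreover have "(y \<otimes> inv x) \<otimes> x = y" "(y \<otimes> inv x) \<otimes> x' = y'"
    using c by (simp add: m_assoc, simp add: eq' m_assoc)
  ultimately show ?L
    using c *
    by (intro bexI[of _ "inv x"] bexI[of _ "inv x'"] bexI[of _ \<one>] bexI[of _ "y \<otimes> inv x"]) auto
qed

text \<open>This much structure on \<open>RG\<close> suffices for the finite sum defining
  \<open>u\<close> to stay in the carrier.\<close>

lemma abelian_monoid_group_ring:
  assumes "ring R"
  shows "abelian_monoid (group_ring R G)"
proof -
  interpret ring R by fact
  show ?thesis
  proof (rule abelian_monoidI)
    fix x y assume "x \<in> carrier (group_ring R G)" "y \<in> carrier (group_ring R G)"
    then have *: "x \<in> carrier G \<rightarrow>\<^sub>E carrier R" "y \<in> carrier G \<rightarrow>\<^sub>E carrier R"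
        "finite ({g \<in> carrier G. x g \<noteq> \<zero>\<^bsub>R\<^esub>} \<union> {g \<in> carrier G. y g \<noteq> \<zero>\<^bsub>R\<^esub>})"
      by (auto simp: group_ring_def)
    \<comment> \<open>The support of a sum lies in the union of the supports.\<close>
    moreover have "finite {g \<in> carrier G. x g \<oplus>\<^bsub>R\<^esub> y g \<noteq> \<zero>\<^bsub>R\<^esub>}"
      using *(3) by (rule rev_finite_subset) auto
    ultimately show "x \<oplus>\<^bsub>group_ring R G\<^esub> y \<in> carrier (group_ring R G)"
      by (auto simp: group_ring_def cong: conj_cong)
  qed (auto simp: group_ring_def PiE_iff extensional_def fun_eq_iff a_ac
      intro!: restrict_ext cong: conj_cong)
qed

lemma smult_group_elem_closed:
  assumes "ring R" "a \<in> carrier R"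
  shows "a \<odot>\<^bsub>group_ring R G\<^esub> group_elem R G g \<in> carrier (group_ring R G)"
proof -
  interpret ring R by fact
  have "finite {x \<in> carrier G. a \<otimes>\<^bsub>R\<^esub> (if x = g then \<one>\<^bsub>R\<^esub> else \<zero>\<^bsub>R\<^esub>) \<noteq> \<zero>\<^bsub>R\<^esub>}"
    using assms by (intro finite_subset[OF _ finite.insertI[OF finite.emptyI, of g]]) auto
  then show ?thesis
    using assms by (auto simp: group_ring_def group_elem_def cong: conj_cong)
qed

text \<open>Only the factorisation of \<open>x\<close> with second factor \<open>g\<close> can
  contribute to the convolution, and its first factor is then forced.\<close>

lemma mult_group_elem:
  assumes "ring R" "group G" "u \<in> carrier G \<rightarrow> carrier R" "g \<in> carrier G" "x \<in> carrier G"
  shows "(u \<otimes>\<^bsub>group_ring R G\<^esub> group_elem R G g) x = u (x \<otimes>\<^bsub>G\<^esub> inv\<^bsub>G\<^esub> g)"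
proof -
  interpret R: ring R by fact
  interpret G: group G by fact
  let ?y = "x \<otimes>\<^bsub>G\<^esub> inv\<^bsub>G\<^esub> g"
  let ?P = "{p \<in> carrier G \<times> carrier G. fst p \<otimes>\<^bsub>G\<^esub> snd p = x \<and> u (fst p) \<noteq> \<zero>\<^bsub>R\<^esub> \<and>
    group_elem R G g (snd p) \<noteq> \<zero>\<^bsub>R\<^esub>}"
  have y: "?y \<in> carrier G" "u ?y \<in> carrier R"
    using assms by auto
  have "?P = {p. p = (?y, g) \<and> u ?y \<noteq> \<zero>\<^bsub>R\<^esub> \<and> \<one>\<^bsub>R\<^esub> \<noteq> \<zero>\<^bsub>R\<^esub>}"
    using assms by (auto simp: group_elem_def G.m_assoc split: if_splits)
  \<comment> \<open>In the zero ring \<open>g\<close> itself has coefficient 0, but then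
    \<open>u ?y\<close> is 0 too, so the case split on \<open>u ?y\<close> alone is correct. An
    empty index set gives the sum 0, which is again \<open>u ?y\<close>.\<close>
  also have "\<dots> = (if u ?y = \<zero>\<^bsub>R\<^esub> then {} else {(?y, g)})"
    using y by (auto dest!: R.one_zeroD)
  finally have "?P = (if u ?y = \<zero>\<^bsub>R\<^esub> then {} else {(?y, g)})" .
  then show ?thesis
    using assms y by (simp add: group_ring_def) (simp add: group_elem_def)
qed

theorem theorem2p2:
  fixes R :: "('r, 'm) ring_scheme"
    and G :: "('g, 'k) monoid_scheme"
    and n :: nat
    and gs :: "'g list"
    and \<alpha> :: "nat \<Rightarrow> 'r"
    and u :: "'g \<Rightarrow> 'r"
  assumes "ring R"
    and "group G" and "finite (carrier G)" and "Coset.order G = n"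
    and "distinct gs" and "set gs = carrier G"
    and "\<And>i. i < n \<Longrightarrow> \<alpha> i \<in> carrier R"
    and "u = (\<Oplus>\<^bsub>group_ring R G\<^esub>i\<in>{..<n}. \<alpha> i \<odot>\<^bsub>group_ring R G\<^esub> group_elem R G (gs ! i))"
  shows "\<not> has_short_cycle R (group_ring_matrix R G gs u) \<longleftrightarrow>
    \<not> has_repeated_element (DS R G gs u)"
proof -
  interpret G: group G by fact
  interpret RG: abelian_monoid "group_ring R G"
    using assms(1) by (rule abelian_monoid_group_ring)
  \<comment> \<open>The expansion of \<open>u\<close> enters here, to show that its coefficients lie
    in \<open>R\<close>; afterwards \<open>u\<close> is handled as a coefficient function.\<close>
  have "u \<in> carrier (group_ring R G)"
    unfolding assms(8) using assms(1,7) by (intro RG.finsum_closed) (auto intro: smult_group_elem_closed)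
  then have u: "u \<in> carrier G \<rightarrow> carrier R"
    by (auto simp: group_ring_def)
  let ?S = "{x \<in> carrier G. u x \<noteq> \<zero>\<^bsub>R\<^esub>}"
  let ?N = "length gs"
  have nth: "gs ! i \<in> carrier G" if "i < ?N" for i
    using that assms(6) nth_mem by blast
  have entry: "group_ring_matrix R G gs u $$ (i, j) \<noteq> \<zero>\<^bsub>R\<^esub> \<longleftrightarrow> gs ! j \<otimes>\<^bsub>G\<^esub> inv\<^bsub>G\<^esub> (gs ! i) \<in> ?S"
    if "i < ?N" "j < ?N" for i j
    using that nth mult_group_elem[OF assms(1,2) u, of "gs ! i" "gs ! j"]
    by (simp add: group_ring_matrix_def)
  have dim: "dim_row (group_ring_matrix R G gs u) = ?N" "dim_col (group_ring_matrix R G gs u) = ?N"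
    by (simp_all add: group_ring_matrix_def)
  have bex: "(\<exists>g\<in>carrier G. P g) \<longleftrightarrow> (\<exists>i<?N. P (gs ! i))" for P
    unfolding assms(6)[symmetric] by (metis in_set_conv_nth)
  \<comment> \<open>Row and column indices are traded for the group elements they list; distinct
    indices correspond to distinct elements because \<open>gs\<close> is distinct.\<close>
  have "has_short_cycle R (group_ring_matrix R G gs u) \<longleftrightarrow>
    (\<exists>g\<in>carrier G. \<exists>h\<in>carrier G. \<exists>a\<in>carrier G. \<exists>b\<in>carrier G. g \<noteq> h \<and> a \<noteq> b \<and>
      a \<otimes>\<^bsub>G\<^esub> inv\<^bsub>G\<^esub> g \<in> ?S \<and> b \<otimes>\<^bsub>G\<^esub> inv\<^bsub>G\<^esub> g \<in> ?S \<and> a \<otimes>\<^bsub>G\<^esub> inv\<^bsub>G\<^esub> h \<in> ?S \<and> b \<otimes>\<^bsub>G\<^esub> inv\<^bsub>G\<^esub> h \<in> ?S)"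
    unfolding has_short_cycle_iff dim bex
    by (simp add: entry nth_eq_iff_index_eq[OF assms(5)] del: mem_Collect_eq cong: conj_cong)
  also have "\<dots> \<longleftrightarrow> \<not> inj_on (\<lambda>(x, y). x \<otimes>\<^bsub>G\<^esub> inv\<^bsub>G\<^esub> y) {(x, y). x \<in> ?S \<and> y \<in> ?S \<and> x \<noteq> y}"
    by (rule G.quotient_rectangle_iff) auto
  also have "{(x, y). x \<in> ?S \<and> y \<in> ?S \<and> x \<noteq> y} =
      {(x, y). x \<in> set gs \<and> y \<in> set gs \<and> x \<noteq> y \<and> u x \<noteq> \<zero>\<^bsub>R\<^esub> \<and> u y \<noteq> \<zero>\<^bsub>R\<^esub>}" (is "_ = ?P")
    using assms(6) by auto
  also have "\<not> inj_on (\<lambda>(x, y). x \<otimes>\<^bsub>G\<^esub> inv\<^bsub>G\<^esub> y) ?P \<longleftrightarrow> has_repeated_element (DS R G gs u)"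
  proof -
    have "finite ?P"
      by (rule finite_subset[of _ "set gs \<times> set gs"]) auto
    then show ?thesis
      unfolding DS_eq[OF assms(5)] by (rule has_repeated_element_image_mset_iff[symmetric])
  qed
  finally show ?thesis
    by simp
qed

end
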